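(* Let $(S,\vdash,\dashv,\alpha)$ be a hom-left symmetric dialgebra over a field $\mathbb{K}$. Then the commutator $[x,y]=x\dashv y-y\vdash x$ defines a structure of hom-Leibniz algebra on $S$; in other words, $(S,[\cdot,\cdot],\alpha)$ is a hom-Leibniz algebra.
   Context: A hom-left symmetric dialgebra is a vector space $S$ with two bilinear products $\dashv,\vdash:S\otimes S\to S$ and a linear map $\alpha:S\to S$ such that for all $x,y,z\in S$: $\alpha(x)\dashv(y\dashv z)=\alpha(x)\dashv(y\vdash z)$; $(x\vdash y)\vdash\alpha(z)=(x\dashv y)\vdash\alpha(z)$; $\alpha(x)\dashv(y\dashv z)-(x\dashv y)\dashv\alpha(z)=\alpha(y)\vdash(x\dashv z)-(y\vdash x)\dashv\alpha(z)$; $\alpha(x)\vdash(y\vdash z)-(x\vdash y)\vdash\alpha(z)=\alpha(y)\vdash(x\vdash z)-(y\vdash x)\vdash\alpha(z)$. A hom-Leibniz algebra $(L,[\cdot,\cdot],\alpha)$ is a vector space $L$ with a bilinear product $[\cdot,\cdot]$ and a linear map $\alpha:L\to L$ such that $[[x,y],\alpha(z)]=[[x,z],\alpha(y)]+[\alpha(x),[y,z]]$ for all $x,y,z\in L$. *)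

theory Defs
  imports Complex_Main
begin

text \<open>
  The vector space is the whole type \<^typ>\<open>'s\<close>, with scalar multiplication \<open>scale\<close> over an
  arbitrary field \<^typ>\<open>'k\<close>. A bilinear product \<open>S \<otimes> S \<rightarrow> S\<close> is given as a curried
  operation that is linear in each argument.
\<close>

definition bilinear_product ::
    "('k::field \<Rightarrow> 's::ab_group_add \<Rightarrow> 's) \<Rightarrow> ('s \<Rightarrow> 's \<Rightarrow> 's) \<Rightarrow> bool" where
  "bilinear_product scale p \<longleftrightarrow>
     (\<forall>x. Vector_Spaces.linear scale scale (\<lambda>y. p x y)) \<and>
     (\<forall>y. Vector_Spaces.linear scale scale (\<lambda>x. p x y))"

text \<open>
  The twisting map \<open>\<alpha>\<close> is only linear: it is not required to be multiplicative.
\<close>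

locale hom_left_symmetric_dialgebra = vector_space scale
  for scale :: "'k::field \<Rightarrow> 's::ab_group_add \<Rightarrow> 's" +
  fixes rprod :: "'s \<Rightarrow> 's \<Rightarrow> 's"  (infixl \<open>\<turnstile>\<close> 70)
    and lprod :: "'s \<Rightarrow> 's \<Rightarrow> 's"  (infixl \<open>\<stileturn>\<close> 70)
    and \<alpha> :: "'s \<Rightarrow> 's"
  assumes bilinear_rprod: "bilinear_product scale (\<turnstile>)"
    and bilinear_lprod: "bilinear_product scale (\<stileturn>)"
    and linear_twist: "Vector_Spaces.linear scale scale \<alpha>"
    and left_bar: "\<alpha> x \<stileturn> (y \<stileturn> z) = \<alpha> x \<stileturn> (y \<turnstile> z)"
    and right_bar: "(x \<turnstile> y) \<turnstile> \<alpha> z = (x \<stileturn> y) \<turnstile> \<alpha> z"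
    and left_symmetric_mixed:
      "\<alpha> x \<stileturn> (y \<stileturn> z) - (x \<stileturn> y) \<stileturn> \<alpha> z
         = \<alpha> y \<turnstile> (x \<stileturn> z) - (y \<turnstile> x) \<stileturn> \<alpha> z"
    and left_symmetric_right:
      "\<alpha> x \<turnstile> (y \<turnstile> z) - (x \<turnstile> y) \<turnstile> \<alpha> z
         = \<alpha> y \<turnstile> (x \<turnstile> z) - (y \<turnstile> x) \<turnstile> \<alpha> z"

locale hom_leibniz_algebra = vector_space scale
  for scale :: "'k::field \<Rightarrow> 's::ab_group_add \<Rightarrow> 's" +
  fixes bracket :: "'s \<Rightarrow> 's \<Rightarrow> 's"
    and \<alpha> :: "'s \<Rightarrow> 's"
  assumes bilinear_bracket: "bilinear_product scale bracket"
    and linear_twist: "Vector_Spaces.linear scale scale \<alpha>"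
    and hom_leibniz_identity:
      "bracket (bracket x y) (\<alpha> z)
         = bracket (bracket x z) (\<alpha> y) + bracket (\<alpha> x) (bracket y z)"

end

theory Submission
  imports Defs
begin

text \<open>
  Write \<open>[x, y] = x \<stileturn> y - y \<turnstile> x\<close>. The mixed left-symmetry axiom evaluates a bracket
  multiplied by a twisted element:
  \<open>[x, y] \<stileturn> \<alpha> z = \<alpha> x \<stileturn> (y \<stileturn> z) - \<alpha> y \<turnstile> (x \<stileturn> z)\<close>.
  Substituting this in \<open>[[x, y], \<alpha> z]\<close> and \<open>[[x, z], \<alpha> y]\<close> leaves the difference of the two
  equal to
  \<open>\<alpha> x \<stileturn> (y \<stileturn> z - z \<stileturn> y) + \<alpha> z \<turnstile> (y \<turnstile> x) - \<alpha> y \<turnstile> (z \<turnstile> x)\<close>,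
  because the terms \<open>\<alpha> y \<turnstile> (x \<stileturn> z)\<close> and \<open>\<alpha> z \<turnstile> (x \<stileturn> y)\<close> occur in both and cancel.

  This is \<open>[\<alpha> x, [y, z]]\<close>. By the left bar identity, \<open>\<alpha> x \<stileturn> [y, z]\<close> is its first summand.
  The rest follows from left symmetry of \<open>\<turnstile>\<close>, which for the elements \<open>z, y, x\<close> gives
  \<open>\<alpha> z \<turnstile> (y \<turnstile> x) - \<alpha> y \<turnstile> (z \<turnstile> x) = (z \<turnstile> y) \<turnstile> \<alpha> x - (y \<turnstile> z) \<turnstile> \<alpha> x\<close>; by the right bar
  identity the right-hand side is \<open>- [y, z] \<turnstile> \<alpha> x\<close>.
\<close>

lemma (in vector_space) bilinear_product_commutator:
  assumes "bilinear_product scale p" and "bilinear_product scale q"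
  shows "bilinear_product scale (\<lambda>x y. p x y - q y x)"
proof -
  interpret vector_space_pair scale scale ..
  show ?thesis
    using assms unfolding bilinear_product_def by (auto intro: linear_compose_sub)
qed

lemma bilinear_product_diff:
  assumes "bilinear_product scale p"
  shows "p (x - y) z = p x z - p y z" and "p x (y - z) = p x y - p x z"
proof -
  have left: "Vector_Spaces.linear scale scale (\<lambda>x. p x z)"
    and right: "Vector_Spaces.linear scale scale (\<lambda>y. p x y)"
    using assms by (auto simp: bilinear_product_def)
  interpret left: Vector_Spaces.linear scale scale "\<lambda>x. p x z" by (rule left)
  interpret right: Vector_Spaces.linear scale scale "\<lambda>y. p x y" by (rule right)
  show "p (x - y) z = p x z - p y z" by (rule left.diff)
  show "p x (y - z) = p x y - p x z" by (rule right.diff)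
qed

context hom_left_symmetric_dialgebra
begin

lemmas product_diff =
  bilinear_product_diff[OF bilinear_rprod] bilinear_product_diff[OF bilinear_lprod]

lemma commutator_lprod_twist:
  "(x \<stileturn> y - y \<turnstile> x) \<stileturn> \<alpha> z = \<alpha> x \<stileturn> (y \<stileturn> z) - \<alpha> y \<turnstile> (x \<stileturn> z)"
  using left_symmetric_mixed[of x y z] by (simp add: product_diff algebra_simps)

lemma twist_lprod_commutator:
  "\<alpha> x \<stileturn> (y \<stileturn> z - z \<turnstile> y) = \<alpha> x \<stileturn> (y \<stileturn> z) - \<alpha> x \<stileturn> (z \<stileturn> y)"
  by (simp add: product_diff left_bar)

lemma commutator_rprod_twist:
  "(y \<stileturn> z - z \<turnstile> y) \<turnstile> \<alpha> x = \<alpha> y \<turnstile> (z \<turnstile> x) - \<alpha> z \<turnstile> (y \<turnstile> x)"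
  using left_symmetric_right[of y z x] right_bar[of y z x]
  by (simp add: product_diff algebra_simps)

lemma commutator_hom_leibniz_identity:
  fixes bracket
  defines "bracket \<equiv> \<lambda>x y. x \<stileturn> y - y \<turnstile> x"
  shows "bracket (bracket x y) (\<alpha> z)
    = bracket (bracket x z) (\<alpha> y) + bracket (\<alpha> x) (bracket y z)"
proof -
  have outer: "bracket (bracket a b) (\<alpha> c)
      = \<alpha> a \<stileturn> (b \<stileturn> c) - \<alpha> b \<turnstile> (a \<stileturn> c) - (\<alpha> c \<turnstile> (a \<stileturn> b) - \<alpha> c \<turnstile> (b \<turnstile> a))" for a b c
    unfolding bracket_def commutator_lprod_twist by (simp only: product_diff)
  have inner: "bracket (\<alpha> x) (bracket y z)
      = \<alpha> x \<stileturn> (y \<stileturn> z) - \<alpha> x \<stileturn> (z \<stileturn> y) - (\<alpha> y \<turnstile> (z \<turnstile> x) - \<alpha> z \<turnstile> (y \<turnstile> x))"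
    unfolding bracket_def twist_lprod_commutator commutator_rprod_twist ..
  show ?thesis
    unfolding outer inner by (simp add: algebra_simps)
qed

end

theorem theorem4p19:
  fixes scale :: "'k::field \<Rightarrow> 's::ab_group_add \<Rightarrow> 's"
    and rprod :: "'s \<Rightarrow> 's \<Rightarrow> 's"  (infixl \<open>\<turnstile>\<close> 70)
    and lprod :: "'s \<Rightarrow> 's \<Rightarrow> 's"  (infixl \<open>\<stileturn>\<close> 70)
    and \<alpha> :: "'s \<Rightarrow> 's"
  assumes "hom_left_symmetric_dialgebra scale (\<turnstile>) (\<stileturn>) \<alpha>"
  shows "hom_leibniz_algebra scale (\<lambda>x y. x \<stileturn> y - y \<turnstile> x) \<alpha>"
proof -
  interpret hom_left_symmetric_dialgebra scale "(\<turnstile>)" "(\<stileturn>)" \<alpha>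
    by (rule assms)
  show ?thesis
    by (intro hom_leibniz_algebra.intro hom_leibniz_algebra_axioms.intro vector_space_axioms
        bilinear_product_commutator bilinear_lprod bilinear_rprod linear_twist
        commutator_hom_leibniz_identity)
qed

end
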